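(* Let $(M,g)$ be the Walker 3-manifold with metric $g$ determined by $\varepsilon\in\{1,-1\}$ and a smooth function $f$, let $\beta,\lambda$ be real constants, and let $V=V^1\partial_x+V^2\partial_y+V^3\partial_z$ be a smooth vector field on $M$. Then $(M,g,V,\beta,\lambda,0)$ (that is, with $\mu=0$) is a Ricci-Yamabe soliton if and only if there exist smooth functions $\mathcal{Z}_1,\mathcal{Z}_2,\mathcal{Z}_3$ depending only on $z$ and a smooth function $\xi$ depending only on $(y,z)$ such that $$\begin{cases} V^1(x,y,z)=-\beta\,\partial_xf(x,y,z)-yx\,\partial_z\mathcal{Z}_1(z)-x\,\partial_z\mathcal{Z}_2(z)-2\lambda x+\xi(y,z), \\ V^2(x,y,z)=-\varepsilon\mathcal{Z}_1(z)x-\lambda y+\mathcal{Z}_3(z), \\ V^3(x,y,z)=\mathcal{Z}_1(z)y+\mathcal{Z}_2(z),\end{cases}$$ and $$\begin{cases}-2x\,\partial_z\mathcal{Z}_1(z)+\partial_y\xi(y,z)+f(x,y,z)\mathcal{Z}_1(z)+\varepsilon\,\partial_z\mathcal{Z}_3(z)=0, \\[4pt] \beta\left(\dfrac{\varepsilon f f_{,11}-f_{,22}}{\varepsilon}\right)+V^1f_{,1}+V^2f_{,2}+V^3f_{,3}+2\partial_3V^1+2f\left(\partial_3V^3+\lambda\right)=0.\end{cases}$$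
   Context: $M$ is a 3-manifold with coordinates $(x,y,z)=(x^1,x^2,x^3)$, $\varepsilon\in\{1,-1\}$, $f=f(x,y,z)$ is a smooth function, and the Walker metric $g$ has matrix $g_{13}=g_{31}=1$, $g_{22}=\varepsilon$, $g_{33}=f$, all other entries $0$. Notation: $f_{,i}=\partial f/\partial x^i$, $f_{,ij}=\partial^2 f/\partial x^i\partial x^j$, $\partial_i=\partial/\partial x^i$ (so $\partial_1=\partial_x$, $\partial_2=\partial_y$, $\partial_3=\partial_z$). $\operatorname{Ric}$ is the Ricci tensor and $\operatorname{Scal}$ the scalar curvature of $g$: $\operatorname{Ric}_{13}=\tfrac12 f_{,11}$, $\operatorname{Ric}_{23}=\tfrac12 f_{,12}$, $\operatorname{Ric}_{33}=\frac{\varepsilon f f_{,11}-f_{,22}}{2\varepsilon}$, $\operatorname{Ric}_{11}=\operatorname{Ric}_{12}=\operatorname{Ric}_{22}=0$, and $\operatorname{Scal}=f_{,11}$. For a smooth vector field $V$ and real constants $\beta,\lambda,\mu$, $(M,g,V,\beta,\lambda,\mu)$ is a Ricci-Yamabe soliton if $2\beta\operatorname{Ric}+\mathcal{L}_Vg=(-2\lambda+\mu\operatorname{Scal})\,g$, where $\mathcal{L}_Vg$ is the Lie derivative.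
   Formalization: M is taken to be an open set of R^3 whose x-lines, and whose y-lines after projection to the (y,z)-plane, meet it in intervals (or not at all); without this a soliton field V can take different forms on different pieces of a line, so no single ξ(y,z) or Z_i(z) need exist. *)

theory Defs
  imports "HOL-Analysis.Analysis"
begin

primrec higher_differentiable_on ::
  "nat \<Rightarrow> ('a::real_normed_vector \<Rightarrow> 'b::real_normed_vector) \<Rightarrow> 'a set \<Rightarrow> bool"
where
  "higher_differentiable_on 0 h S \<longleftrightarrow> continuous_on S h"
| "higher_differentiable_on (Suc n) h S \<longleftrightarrow>
     (\<forall>x\<in>S. h differentiable (at x)) \<and>
     (\<forall>v. higher_differentiable_on n (\<lambda>x. frechet_derivative h (at x) v) S)"

text \<open>Only meant for open \<open>S\<close>: the derivatives are two-sided ones, taken at points of \<open>S\<close>.\<close>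

definition smooth_on ::
  "('a::real_normed_vector \<Rightarrow> 'b::real_normed_vector) \<Rightarrow> 'a set \<Rightarrow> bool"
where
  "smooth_on h S \<longleftrightarrow> (\<forall>n. higher_differentiable_on n h S)"

definition pd :: "'n::finite \<Rightarrow> (real^'n \<Rightarrow> real) \<Rightarrow> real^'n \<Rightarrow> real" where
  "pd i h p = frechet_derivative h (at p) (axis i 1)"

text \<open>
  A metric on a coordinate domain is given by its component matrix \<open>g p $ i $ j\<close>.
  Christoffel symbols \<open>christoffel g k i j\<close> are those of the second kind, with upper index
  \<open>k\<close>. The sign convention of the curvature is the one for which round spheres have
  positive Ricci tensor.
\<close>

definition christoffel ::
  "(real^'n \<Rightarrow> real^'n^'n) \<Rightarrow> 'n::finite \<Rightarrow> 'n \<Rightarrow> 'n \<Rightarrow> real^'n \<Rightarrow> real"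
where
  "christoffel g k i j p =
     (\<Sum>l\<in>UNIV. matrix_inv (g p) $ k $ l *
        (pd i (\<lambda>q. g q $ j $ l) p + pd j (\<lambda>q. g q $ i $ l) p - pd l (\<lambda>q. g q $ i $ j) p)) / 2"

definition ricci ::
  "(real^'n \<Rightarrow> real^'n^'n) \<Rightarrow> real^'n \<Rightarrow> 'n::finite \<Rightarrow> 'n \<Rightarrow> real"
where
  "ricci g p i j =
     (\<Sum>k\<in>UNIV. pd k (christoffel g k i j) p) - (\<Sum>k\<in>UNIV. pd j (christoffel g k k i) p)
     + (\<Sum>k\<in>UNIV. \<Sum>l\<in>UNIV. christoffel g k k l p * christoffel g l i j p)
     - (\<Sum>k\<in>UNIV. \<Sum>l\<in>UNIV. christoffel g k j l p * christoffel g l k i p)"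

definition scalar_curvature :: "(real^'n \<Rightarrow> real^'n^'n) \<Rightarrow> real^'n::finite \<Rightarrow> real" where
  "scalar_curvature g p = (\<Sum>i\<in>UNIV. \<Sum>j\<in>UNIV. matrix_inv (g p) $ i $ j * ricci g p i j)"

definition lie_derivative_metric ::
  "(real^'n \<Rightarrow> real^'n) \<Rightarrow> (real^'n \<Rightarrow> real^'n^'n) \<Rightarrow> real^'n \<Rightarrow> 'n::finite \<Rightarrow> 'n \<Rightarrow> real"
where
  "lie_derivative_metric V g p i j =
     (\<Sum>k\<in>UNIV. V p $ k * pd k (\<lambda>q. g q $ i $ j) p
        + g p $ k $ j * pd i (\<lambda>q. V q $ k) p
        + g p $ i $ k * pd j (\<lambda>q. V q $ k) p)"

definition ricci_yamabe_soliton ::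
  "(real^'n) set \<Rightarrow> (real^'n \<Rightarrow> real^'n^'n) \<Rightarrow> (real^'n \<Rightarrow> real^'n::finite) \<Rightarrow>
     real \<Rightarrow> real \<Rightarrow> real \<Rightarrow> bool"
where
  "ricci_yamabe_soliton M g V \<beta> lam \<mu> \<longleftrightarrow>
     (\<forall>p\<in>M. \<forall>i j. 2 * \<beta> * ricci g p i j + lie_derivative_metric V g p i j
        = (-2 * lam + \<mu> * scalar_curvature g p) * g p $ i $ j)"

text \<open>The coordinates \<open>(x, y, z)\<close> are the components \<open>1, 2, 3\<close> of a point of \<open>real^3\<close>.\<close>

definition walker_metric :: "real \<Rightarrow> (real^3 \<Rightarrow> real) \<Rightarrow> real^3 \<Rightarrow> real^3^3" where
  "walker_metric \<epsilon> f p = vector [vector [0, 0, 1],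
                                 vector [0, \<epsilon>, 0],
                                 vector [1, 0, f p]]"

end

theory Submission
  imports Defs
begin

text \<open>
  In coordinates the soliton equation consists of six scalar equations. On \<open>M\<close> consider
  \<open>G1 = \<partial>\<^sub>2 V\<^sup>3\<close>, \<open>G2 = V\<^sup>3 - y G1\<close>, \<open>G3 = V\<^sup>2 + \<epsilon> x G1 + \<lambda> y\<close> and
  \<open>X = V\<^sup>1 + \<beta> \<partial>\<^sub>1 f + x \<partial>\<^sub>3 V\<^sup>3 + 2 \<lambda> x\<close>. Since mixed partial derivatives commute, the
  equations with indices 11, 12, 13, 22 make the \<open>x\<close>- and \<open>y\<close>-derivatives of \<open>G1, G2, G3\<close>
  and the \<open>x\<close>-derivative of \<open>X\<close> vanish. By connectedness of the fibres these functions
  descend to \<open>Z1, Z2, Z3\<close> and \<open>\<xi>\<close>, and the remaining equations 23 and 33 become the two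
  constraints. The converse is differentiation along coordinate lines.
\<close>

subsection \<open>Higher differentiability\<close>

lemma higher_differentiable_on_SucD:
  "higher_differentiable_on (Suc n) h S \<Longrightarrow> higher_differentiable_on n h S"
proof (induction n arbitrary: h)
  case 0
  then show ?case
    by (auto intro!: continuous_at_imp_continuous_on differentiable_imp_continuous_within)
next
  case (Suc n)
  then show ?case
    by (metis higher_differentiable_on.simps(2))
qed

text \<open>On an open set, agreement on \<open>S\<close> is agreement near each of its points, so
  the derivatives coincide on \<open>S\<close> as well and the induction passes to them.\<close>

lemma higher_differentiable_on_cong:
  assumes "open S" "\<And>x. x \<in> S \<Longrightarrow> g x = h x" "higher_differentiable_on n g S"
  shows "higher_differentiable_on n h S"
  using assms(2,3)
proof (induction n arbitrary: g h)
  case 0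
  show ?case using continuous_on_eq[of S g h, OF _ 0(1)] 0(2) by simp
next
  case (Suc n)
  have D: "(h has_derivative frechet_derivative g (at x)) (at x)" if "x \<in> S" for x
  proof (rule has_derivative_transform_within_open[OF _ assms(1) that Suc.prems(1)])
    show "(g has_derivative frechet_derivative g (at x)) (at x)"
      using Suc.prems(2) that by (simp add: frechet_derivative_works[symmetric])
  qed
  then have "h differentiable (at x)" if "x \<in> S" for x
    using that by (auto simp: differentiable_def)
  moreover have "higher_differentiable_on n (\<lambda>x. frechet_derivative h (at x) v) S" for v
  proof (rule Suc.IH)
    show "frechet_derivative g (at x) v = frechet_derivative h (at x) v" if "x \<in> S" for x
      by (rule fun_cong[OF frechet_derivative_at[OF D[OF that]]])
    show "higher_differentiable_on n (\<lambda>x. frechet_derivative g (at x) v) S"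
      using Suc.prems by simp
  qed
  ultimately show ?case by simp
qed

text \<open>Lets a closure proof work with an explicit derivative \<open>h'\<close> instead of the
  opaque \<open>frechet_derivative\<close> term. Both agree on \<open>S\<close> by uniqueness of
  derivatives.\<close>

lemma higher_differentiable_on_SucI:
  assumes "open S" "\<And>x. x \<in> S \<Longrightarrow> (h has_derivative h' x) (at x)"
    and "\<And>v. higher_differentiable_on n (\<lambda>x. h' x v) S"
  shows "higher_differentiable_on (Suc n) h S"
proof -
  have "higher_differentiable_on n (\<lambda>x. frechet_derivative h (at x) v) S" for v
    by (rule higher_differentiable_on_cong[OF assms(1) _ assms(3)])
      (rule fun_cong[OF frechet_derivative_at[OF assms(2)]])
  then show ?thesis using assms(2) by (auto simp: differentiable_def)
qed

text \<open>Continuity on an open set and differentiability are conditions at single points. This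
  serves functions that admit a smooth description only near each point, with a different one from
  point to point.\<close>

lemma higher_differentiable_on_local:
  assumes "\<And>x. x \<in> S \<Longrightarrow> \<exists>U. open U \<and> x \<in> U \<and> higher_differentiable_on n h U"
  shows "higher_differentiable_on n h S"
  using assms
proof (induction n arbitrary: h)
  case 0
  then show ?case
    by (simp, intro continuous_at_imp_continuous_on ballI) (metis continuous_on_eq_continuous_at)
next
  case (Suc n)
  then show ?case by fastforce
qed

lemma higher_differentiable_on_const:
  "open S \<Longrightarrow> higher_differentiable_on n (\<lambda>x. c) S"
proof (induction n arbitrary: c)
  case (Suc n)
  then show ?case
    by (intro higher_differentiable_on_SucI[where h' = "\<lambda>x v. 0"]) auto
qed simp

lemma higher_differentiable_on_add:
  assumes "open S"
  shows "higher_differentiable_on n g S \<Longrightarrow> higher_differentiable_on n h S \<Longrightarrow>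
    higher_differentiable_on n (\<lambda>x. g x + h x) S"
proof (induction n arbitrary: g h)
  case 0
  then show ?case by (auto intro: continuous_on_add)
next
  case (Suc n)
  have "((\<lambda>x. g x + h x) has_derivative
      (\<lambda>v. frechet_derivative g (at x) v + frechet_derivative h (at x) v)) (at x)"
    if "x \<in> S" for x
    using Suc.prems that by (intro has_derivative_add) (auto simp: frechet_derivative_works[symmetric])
  then show ?case
    by (rule higher_differentiable_on_SucI[OF assms]) (use Suc in auto)
qed

lemma higher_differentiable_on_mult:
  fixes g h :: "'a::real_normed_vector \<Rightarrow> real"
  assumes "open S"
  shows "higher_differentiable_on n g S \<Longrightarrow> higher_differentiable_on n h S \<Longrightarrow>
    higher_differentiable_on n (\<lambda>x. g x * h x) S"
proof (induction n arbitrary: g h)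
  case 0
  then show ?case by (auto intro: continuous_on_mult)
next
  case (Suc n)
  have "((\<lambda>x. g x * h x) has_derivative
      (\<lambda>v. g x * frechet_derivative h (at x) v + frechet_derivative g (at x) v * h x)) (at x)"
    if "x \<in> S" for x
    using Suc.prems that by (intro has_derivative_mult) (auto simp: frechet_derivative_works[symmetric])
  \<comment> \<open>The product rule pairs a derivative, of order \<open>n\<close>, with an
    undifferentiated factor, so the factors are lowered from order \<open>Suc n\<close> to order
    \<open>n\<close>.\<close>
  moreover have "higher_differentiable_on n g S" "higher_differentiable_on n h S"
    using Suc.prems higher_differentiable_on_SucD by blast+
  then have "higher_differentiable_on n
      (\<lambda>x. g x * frechet_derivative h (at x) v + frechet_derivative g (at x) v * h x) S" for v
    using Suc by (intro higher_differentiable_on_add[OF assms] Suc.IH) auto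
  ultimately show ?case by (rule higher_differentiable_on_SucI[OF assms])
qed

lemma higher_differentiable_on_bounded_linear:
  assumes "bounded_linear L" "open S"
  shows "higher_differentiable_on n h S \<Longrightarrow> higher_differentiable_on n (\<lambda>x. L (h x)) S"
proof (induction n arbitrary: h)
  case 0
  then show ?case by (auto intro: bounded_linear.continuous_on[OF assms(1)])
next
  case (Suc n)
  have "((\<lambda>x. L (h x)) has_derivative (\<lambda>v. L (frechet_derivative h (at x) v))) (at x)"
    if "x \<in> S" for x
    using Suc.prems that
    by (intro bounded_linear.has_derivative[OF assms(1)]) (auto simp: frechet_derivative_works[symmetric])
  then show ?case
    by (rule higher_differentiable_on_SucI[OF assms(2)]) (use Suc in auto)
qed

text \<open>For an affine inner map the derivative in direction \<open>v\<close> is the derivative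
  of \<open>h\<close> in the fixed direction \<open>L v\<close>, composed with the same map. The
  induction therefore closes without a higher-order chain rule.\<close>

lemma higher_differentiable_on_compose_affine:
  assumes "bounded_linear L" "open T" "\<And>x. x \<in> T \<Longrightarrow> a + L x \<in> S"
  shows "higher_differentiable_on n h S \<Longrightarrow> higher_differentiable_on n (\<lambda>x. h (a + L x)) T"
proof (induction n arbitrary: h)
  case 0
  then show ?case using assms
    by (auto intro!: continuous_on_compose2[of S h] continuous_intros
        bounded_linear.continuous_on[OF assms(1)])
next
  case (Suc n)
  have "((\<lambda>x. h (a + L x)) has_derivative (\<lambda>v. frechet_derivative h (at (a + L x)) (L v))) (at x)"
    if "x \<in> T" for x
  proof (rule has_derivative_compose[of "\<lambda>x. a + L x"])
    show "((\<lambda>x. a + L x) has_derivative L) (at x)"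
      by (auto intro!: derivative_eq_intros bounded_linear.has_derivative[OF assms(1)])
  qed (use Suc.prems assms(3) that in \<open>auto simp: frechet_derivative_works[symmetric]\<close>)
  then show ?case
    by (rule higher_differentiable_on_SucI[OF assms(2)]) (use Suc in auto)
qed

lemma higher_differentiable_on_linear:
  assumes "bounded_linear L" "open S"
  shows "higher_differentiable_on n L S"
proof (cases n)
  case 0
  then show ?thesis by (simp add: bounded_linear.continuous_on[OF assms(1)])
next
  case (Suc m)
  then show ?thesis
    using assms higher_differentiable_on_SucI[OF assms(2), where h' = "\<lambda>_. L"]
    by (simp add: bounded_linear_imp_has_derivative higher_differentiable_on_const
        del: higher_differentiable_on.simps)
qed

section \<open>Mean values and the symmetry of second derivatives\<close>

lemma has_real_derivative_along_line:
  fixes k :: "'a::real_normed_vector \<Rightarrow> real"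
  assumes "k differentiable (at (a + t *\<^sub>R w))"
  shows "((\<lambda>t. k (a + t *\<^sub>R w)) has_real_derivative
    frechet_derivative k (at (a + t *\<^sub>R w)) w) (at t)"
proof -
  have D: "(k has_derivative frechet_derivative k (at (a + t *\<^sub>R w))) (at (a + t *\<^sub>R w))"
    using assms by (simp add: frechet_derivative_works[symmetric])
  have "((\<lambda>t. a + t *\<^sub>R w) has_derivative (\<lambda>s. s *\<^sub>R w)) (at t)"
    by (auto intro!: derivative_eq_intros)
  from has_derivative_compose[OF this D] show ?thesis
    using linear_scale[OF has_derivative_linear[OF D]]
    by (simp add: has_field_derivative_def mult_commute_abs)
qed

text \<open>The mean value theorem is applied twice: first along \<open>u\<close> to the increment
  of \<open>h\<close> in direction \<open>r v\<close>, then along \<open>v\<close> to the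
  directional derivative \<open>Du\<close>.\<close>

lemma mixed_difference_mean_value:
  fixes h :: "'a::real_normed_vector \<Rightarrow> real"
  assumes "0 < r"
    and box: "\<And>s t. 0 \<le> s \<Longrightarrow> s \<le> r \<Longrightarrow> 0 \<le> t \<Longrightarrow> t \<le> r \<Longrightarrow> p + s *\<^sub>R u + t *\<^sub>R v \<in> S"
    and h: "higher_differentiable_on 2 h S"
  obtains s t where "0 < s" "s < r" "0 < t" "t < r"
    "h (p + r *\<^sub>R u + r *\<^sub>R v) - h (p + r *\<^sub>R u) - h (p + r *\<^sub>R v) + h p =
       r * r * frechet_derivative (\<lambda>q. frechet_derivative h (at q) u) (at (p + s *\<^sub>R u + t *\<^sub>R v)) v"
proof -
  define Du where "Du = (\<lambda>q. frechet_derivative h (at q) u)"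
  have diff: "h differentiable (at q)" "Du differentiable (at q)" if "q \<in> S" for q
    using h that by (auto simp: numeral_2_eq_2 Du_def)
  have 1: "((\<lambda>s. h (p + s *\<^sub>R u + r *\<^sub>R v) - h (p + s *\<^sub>R u)) has_real_derivative
      Du (p + s *\<^sub>R u + r *\<^sub>R v) - Du (p + s *\<^sub>R u)) (at s)" if "0 \<le> s" "s \<le> r" for s
  proof (rule DERIV_diff)
    show "((\<lambda>s. h (p + s *\<^sub>R u)) has_real_derivative Du (p + s *\<^sub>R u)) (at s)"
      using diff(1) box[of s 0] that \<open>0 < r\<close> unfolding Du_def
      by (intro has_real_derivative_along_line) simp
    have "p + s *\<^sub>R u + r *\<^sub>R v = (p + r *\<^sub>R v) + s *\<^sub>R u" for s by simp
    moreover have "((\<lambda>s. h (p + r *\<^sub>R v + s *\<^sub>R u)) has_real_derivative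
        Du (p + r *\<^sub>R v + s *\<^sub>R u)) (at s)"
      using diff(1) box[of s r] that \<open>0 < r\<close> unfolding Du_def
      by (intro has_real_derivative_along_line) (simp add: add_ac)
    ultimately show "((\<lambda>s. h (p + s *\<^sub>R u + r *\<^sub>R v)) has_real_derivative Du (p + s *\<^sub>R u + r *\<^sub>R v)) (at s)"
      by presburger
  qed
  obtain s where s: "0 < s" "s < r"
    and *: "(h (p + r *\<^sub>R u + r *\<^sub>R v) - h (p + r *\<^sub>R u)) - (h (p + 0 *\<^sub>R u + r *\<^sub>R v) - h (p + 0 *\<^sub>R u))
      = (r - 0) * (Du (p + s *\<^sub>R u + r *\<^sub>R v) - Du (p + s *\<^sub>R u))"
    using MVT2[OF \<open>0 < r\<close> 1] by blast
  have 2: "((\<lambda>t. Du (p + s *\<^sub>R u + t *\<^sub>R v)) has_real_derivative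
      frechet_derivative Du (at (p + s *\<^sub>R u + t *\<^sub>R v)) v) (at t)" if "0 \<le> t" "t \<le> r" for t
    using diff(2) box[of s t] that s by (intro has_real_derivative_along_line) simp
  obtain t where t: "0 < t" "t < r"
    and **: "Du (p + s *\<^sub>R u + r *\<^sub>R v) - Du (p + s *\<^sub>R u + 0 *\<^sub>R v)
      = (r - 0) * frechet_derivative Du (at (p + s *\<^sub>R u + t *\<^sub>R v)) v"
    using MVT2[OF \<open>0 < r\<close> 2] by blast
  show thesis
    using * ** by (intro that[OF s t]) (simp add: Du_def)
qed

text \<open>Both mixed second derivatives are values near \<open>p\<close> of the same mixed difference quotient.\<close>

lemma frechet_derivative_commute:
  fixes h :: "'a::real_normed_vector \<Rightarrow> real"
  assumes "open S" "p \<in> S" and h: "higher_differentiable_on 2 h S"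
  shows "frechet_derivative (\<lambda>q. frechet_derivative h (at q) u) (at p) v =
    frechet_derivative (\<lambda>q. frechet_derivative h (at q) v) (at p) u"
proof -
  define D where "D = (\<lambda>u v q. frechet_derivative (\<lambda>q. frechet_derivative h (at q) u) (at q) v)"
  have cont: "isCont (D u v) p" for u v
    using h assms(1,2) by (auto simp: numeral_2_eq_2 D_def continuous_on_eq_continuous_at)
  have close: "dist (D u v p) (D v u p) \<le> 2 * e" if "0 < e" for e
  proof -
    have "\<forall>\<^sub>F q in nhds p. q \<in> S \<and> dist (D u v q) (D u v p) < e \<and> dist (D v u q) (D v u p) < e"
      using cont[of u v] cont[of v u] assms(1,2) that
      by (intro eventually_conj eventually_nhds_in_open tendstoD)
        (auto simp: isCont_def tendsto_at_iff_tendsto_nhds)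
    then obtain d where d: "0 < d"
      "\<And>q. dist q p < d \<Longrightarrow> q \<in> S \<and> dist (D u v q) (D u v p) < e \<and> dist (D v u q) (D v u p) < e"
      by (auto simp: eventually_nhds_metric)
    \<comment> \<open>With this \<open>r\<close> the whole parallelogram spanned by
      \<open>r u\<close> and \<open>r v\<close> at \<open>p\<close> stays within distance
      \<open>d\<close> of \<open>p\<close>. The summand 1 keeps the denominator positive even for
      \<open>u = v = 0\<close> and makes the bound strict.\<close>
    define r where "r = d / (1 + norm u + norm v)"
    have pos: "0 < 1 + norm u + norm v"
      by (smt (verit) norm_ge_zero)
    then have "0 < r" using d(1) by (simp add: r_def)
    have near: "dist (p + s *\<^sub>R u + t *\<^sub>R v) p < d" if "0 \<le> s" "s \<le> r" "0 \<le> t" "t \<le> r" for s t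
    proof -
      have "dist (p + s *\<^sub>R u + t *\<^sub>R v) p \<le> s * norm u + t * norm v"
        using norm_triangle_ineq[of "s *\<^sub>R u" "t *\<^sub>R v"] that by (simp add: dist_norm add.assoc)
      also have "\<dots> \<le> r * norm u + r * norm v"
        using that by (intro add_mono mult_right_mono) auto
      also have "\<dots> < r * (1 + norm u + norm v)"
        using \<open>0 < r\<close> by (simp add: algebra_simps)
      also have "\<dots> = d" using pos by (simp add: r_def)
      finally show ?thesis .
    qed
    have swap: "p + s *\<^sub>R v + t *\<^sub>R u = p + t *\<^sub>R u + s *\<^sub>R v" for s t by simp
    have box: "p + s *\<^sub>R u + t *\<^sub>R v \<in> S" "p + s *\<^sub>R v + t *\<^sub>R u \<in> S"
      if "0 \<le> s" "s \<le> r" "0 \<le> t" "t \<le> r" for s t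
      unfolding swap using near d(2) that by auto
    obtain s t where 1: "0 < s" "s < r" "0 < t" "t < r"
      "h (p + r *\<^sub>R u + r *\<^sub>R v) - h (p + r *\<^sub>R u) - h (p + r *\<^sub>R v) + h p =
        r * r * D u v (p + s *\<^sub>R u + t *\<^sub>R v)"
      unfolding D_def
      by (rule mixed_difference_mean_value[OF \<open>0 < r\<close> _ h, of p u v]) (use box in auto)
    obtain s' t' where 2: "0 < s'" "s' < r" "0 < t'" "t' < r"
      "h (p + r *\<^sub>R v + r *\<^sub>R u) - h (p + r *\<^sub>R v) - h (p + r *\<^sub>R u) + h p =
        r * r * D v u (p + s' *\<^sub>R v + t' *\<^sub>R u)"
      unfolding D_def
      by (rule mixed_difference_mean_value[OF \<open>0 < r\<close> _ h, of p v u]) (use box in auto)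
    \<comment> \<open>The mixed difference is symmetric in \<open>u\<close> and \<open>v\<close>, so
      the two mean values coincide. Each lies within \<open>e\<close> of its value at
      \<open>p\<close>, which accounts for the bound \<open>2 * e\<close>.\<close>
    have "r * r * D u v (p + s *\<^sub>R u + t *\<^sub>R v) = r * r * D v u (p + s' *\<^sub>R v + t' *\<^sub>R u)"
      using 1(5) 2(5) unfolding swap[of r r] by linarith
    then have "D u v (p + s *\<^sub>R u + t *\<^sub>R v) = D v u (p + t' *\<^sub>R u + s' *\<^sub>R v)"
      using \<open>0 < r\<close> swap[of s' t'] by simp
    moreover have "dist (D u v (p + s *\<^sub>R u + t *\<^sub>R v)) (D u v p) < e"
      using d(2) near 1 by simp
    moreover have "dist (D v u (p + t' *\<^sub>R u + s' *\<^sub>R v)) (D v u p) < e"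
      using d(2) near 2 by simp
    ultimately show ?thesis by (simp add: dist_real_def)
  qed
  have "dist (D u v p) (D v u p) \<le> 0"
  proof (rule field_le_epsilon)
    show "dist (D u v p) (D v u p) \<le> 0 + e" if "0 < e" for e
      using close[of "e / 2"] that by simp
  qed
  then show ?thesis by (simp add: D_def)
qed

subsection \<open>Smooth functions and partial derivatives\<close>

lemma smooth_on_imp_differentiable: "smooth_on h S \<Longrightarrow> x \<in> S \<Longrightarrow> h differentiable (at x)"
  unfolding smooth_on_def by (metis higher_differentiable_on.simps(2))

lemma smooth_on_pd: "smooth_on h S \<Longrightarrow> smooth_on (pd i h) S"
  unfolding smooth_on_def pd_def by (metis higher_differentiable_on.simps(2))

lemma smooth_on_add: "open S \<Longrightarrow> smooth_on g S \<Longrightarrow> smooth_on h S \<Longrightarrow> smooth_on (\<lambda>x. g x + h x) S"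
  by (simp add: smooth_on_def higher_differentiable_on_add)

lemma smooth_on_mult:
  fixes g h :: "'a::real_normed_vector \<Rightarrow> real"
  shows "open S \<Longrightarrow> smooth_on g S \<Longrightarrow> smooth_on h S \<Longrightarrow> smooth_on (\<lambda>x. g x * h x) S"
  by (simp add: smooth_on_def higher_differentiable_on_mult)

lemma smooth_on_const: "open S \<Longrightarrow> smooth_on (\<lambda>x. c) S"
  by (simp add: smooth_on_def higher_differentiable_on_const)

lemma smooth_on_minus:
  fixes h :: "'a::real_normed_vector \<Rightarrow> real"
  assumes "open S" "smooth_on h S"
  shows "smooth_on (\<lambda>x. - h x) S"
  using smooth_on_mult[OF assms(1) smooth_on_const[OF assms(1), of "-1"] assms(2)] by simp

lemma smooth_on_diff:
  fixes g h :: "'a::real_normed_vector \<Rightarrow> real"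
  shows "open S \<Longrightarrow> smooth_on g S \<Longrightarrow> smooth_on h S \<Longrightarrow> smooth_on (\<lambda>x. g x - h x) S"
  using smooth_on_add[of S g "\<lambda>x. - h x"] by (simp add: smooth_on_minus)

lemma smooth_on_coord: "open S \<Longrightarrow> smooth_on (\<lambda>x::real^'n. x $ i) S"
  by (simp add: smooth_on_def higher_differentiable_on_linear bounded_linear_vec_nth)

lemma smooth_on_component: "open S \<Longrightarrow> smooth_on h S \<Longrightarrow> smooth_on (\<lambda>x. h x $ i :: real) S"
  using higher_differentiable_on_bounded_linear[OF bounded_linear_vec_nth[of i]]
  by (auto simp: smooth_on_def)

lemmas smooth_on_intros = smooth_on_add smooth_on_mult smooth_on_const smooth_on_minus
  smooth_on_diff smooth_on_coord smooth_on_component smooth_on_pd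

section \<open>Rules for partial derivatives\<close>

lemma pd_eqI: "(h has_derivative D) (at p) \<Longrightarrow> pd i h p = D (axis i 1)"
  unfolding pd_def by (metis frechet_derivative_at)

lemma pd_const [simp]: "pd i (\<lambda>q. c) p = 0"
  by (simp add: pd_def)

lemma pd_add:
  assumes "g differentiable (at p)" "h differentiable (at p)"
  shows "pd i (\<lambda>q. g q + h q) p = pd i g p + pd i h p"
  using pd_eqI[OF has_derivative_add[OF assms[unfolded frechet_derivative_works]]] by (simp add: pd_def)

lemma pd_diff:
  assumes "g differentiable (at p)" "h differentiable (at p)"
  shows "pd i (\<lambda>q. g q - h q) p = pd i g p - pd i h p"
  using pd_eqI[OF has_derivative_diff[OF assms[unfolded frechet_derivative_works]]] by (simp add: pd_def)

lemma pd_mult: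
  assumes "g differentiable (at p)" "h differentiable (at p)"
  shows "pd i (\<lambda>q. g q * h q) p = g p * pd i h p + pd i g p * h p"
  using pd_eqI[OF has_derivative_mult[OF assms[unfolded frechet_derivative_works]]] by (simp add: pd_def)

lemma pd_minus:
  assumes "g differentiable (at p)"
  shows "pd i (\<lambda>q. - g q) p = - pd i g p"
  using pd_eqI[OF has_derivative_minus[OF assms[unfolded frechet_derivative_works]]] by (simp add: pd_def)

lemma pd_divide:
  assumes "g differentiable (at p)"
  shows "pd i (\<lambda>q. g q / c) p = pd i g p / c"
  using pd_mult[OF assms differentiable_const[of "inverse c"]] by (simp add: divide_inverse)

lemma pd_coord: "pd i (\<lambda>q. q $ j) p = (if i = j then 1 else 0)"
  by (simp add: pd_eqI[OF bounded_linear_imp_has_derivative[OF bounded_linear_vec_nth]] axis_def)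

lemma pd_commute:
  "open M \<Longrightarrow> smooth_on h M \<Longrightarrow> p \<in> M \<Longrightarrow> pd i (pd j h) p = pd j (pd i h) p"
  unfolding pd_def using frechet_derivative_commute[of M p h] by (auto simp: smooth_on_def)

lemma pd_cong:
  assumes "open M" "p \<in> M" "\<And>q. q \<in> M \<Longrightarrow> g q = h q" "g differentiable (at p)"
  shows "pd i g p = pd i h p"
  using frechet_derivative_transform_within_open[OF assms(4,1,2,3)] by (simp add: pd_def)

subsection \<open>Curvature of Walker metrics\<close>

text \<open>\<open>matrix_inv\<close> is given by a choice operator. The chosen matrix is a right
  inverse of \<open>A\<close>, and multiplying by \<open>B\<close> from the left identifies it with
  \<open>B\<close>.\<close>

lemma matrix_inv_eqI:
  fixes A B :: "real^'n^'n"
  assumes "A ** B = mat 1" "B ** A = mat 1"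
  shows "matrix_inv A = B"
proof -
  have "A ** matrix_inv A = mat 1"
    unfolding matrix_inv_def by (rule someI2[of _ B]) (use assms in auto)
  then show ?thesis
    by (metis assms(2) matrix_mul_assoc matrix_mul_lid matrix_mul_rid)
qed

text \<open>The middle entry is its own inverse because \<epsilon> squares to 1, and the corner
  entry \<open>- f p\<close> cancels the 33 entry of the metric in the product.\<close>

lemma matrix_inv_walker:
  assumes "\<epsilon> \<in> {1, -1}"
  shows "matrix_inv (walker_metric \<epsilon> f p) =
    vector [vector [- f p, 0, 1], vector [0, \<epsilon>, 0], vector [1, 0, 0]]"
  using assms
  by (intro matrix_inv_eqI)
    (auto simp: walker_metric_def vec_eq_iff forall_3 matrix_matrix_mult_def sum_3 mat_def)

text \<open>Only the 33 entry of the metric varies, hence a nonzero symbol needs a lower index 3.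
  The equality is between functions, so that it rewrites the symbols under the \<open>pd\<close> in
  \<open>ricci\<close>.\<close>

lemma christoffel_walker:
  assumes "\<epsilon> \<in> {1, -1}"
  shows "christoffel (walker_metric \<epsilon> f) k i j = (\<lambda>p.
    if k = 1 then if i = 3 \<and> j = 3 then (f p * pd 1 f p + pd 3 f p) / 2
       else if i = 3 then pd j f p / 2 else if j = 3 then pd i f p / 2 else 0
    else if i = 3 \<and> j = 3 then if k = 2 then - \<epsilon> * pd 2 f p / 2 else - pd 1 f p / 2
    else 0)"
proof
  fix p
  show "christoffel (walker_metric \<epsilon> f) k i j p = (
    if k = 1 then if i = 3 \<and> j = 3 then (f p * pd 1 f p + pd 3 f p) / 2
       else if i = 3 then pd j f p / 2 else if j = 3 then pd i f p / 2 else 0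
    else if i = 3 \<and> j = 3 then if k = 2 then - \<epsilon> * pd 2 f p / 2 else - pd 1 f p / 2
    else 0)"
    using exhaust_3[of i] exhaust_3[of j] exhaust_3[of k]
    by (elim disjE) (simp_all add: christoffel_def matrix_inv_walker[OF assms] sum_3,
      simp_all add: walker_metric_def)
qed

text \<open>The factor \<epsilon> in the 33 component stands for 1 / \<epsilon>, the two being
  equal.\<close>

lemma ricci_walker:
  assumes "\<epsilon> \<in> {1, -1}" "open M" "smooth_on f M" "p \<in> M"
  shows "ricci (walker_metric \<epsilon> f) p i j =
    (if i = 3 \<and> j = 3 then (f p * pd 1 (pd 1 f) p - \<epsilon> * pd 2 (pd 2 f) p) / 2
     else if i = 3 then pd 1 (pd j f) p / 2 else if j = 3 then pd 1 (pd i f) p / 2 else 0)"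
proof -
  have [simp]: "f differentiable (at p)" "pd k f differentiable (at p)" for k
    using assms by (auto intro: smooth_on_imp_differentiable smooth_on_pd)
  \<comment> \<open>In the 33 component the mixed x-z derivatives of \<open>f\<close> enter with
    opposite signs and cancel once they are in the same order.\<close>
  have [simp]: "pd 3 (pd 1 f) p = pd 1 (pd 3 f) p"
    using pd_commute assms by blast
  show ?thesis
    using exhaust_3[of i] exhaust_3[of j]
    by (elim disjE)
      (simp_all add: ricci_def sum_3 christoffel_walker[OF assms(1)] pd_add pd_mult pd_minus pd_divide
        differentiable_add differentiable_mult, (simp add: field_simps)?)
qed

text \<open>The metric lowers the index of V: index 1 selects V^3, index 2 selects \<epsilon> V^2,
  and index 3 selects V^1 together with \<open>f\<close> times V^3. The derivative of the metric
  along V is felt in the 33 entry only.\<close>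

lemma lie_derivative_walker:
  "lie_derivative_metric V (walker_metric \<epsilon> f) p i j =
    (if i = 3 \<and> j = 3 then V p $ 1 * pd 1 f p + V p $ 2 * pd 2 f p + V p $ 3 * pd 3 f p
     else 0) + (if j = 1 then pd i (\<lambda>q. V q $ 3) p
     else if j = 2 then \<epsilon> * pd i (\<lambda>q. V q $ 2) p
     else pd i (\<lambda>q. V q $ 1) p + f p * pd i (\<lambda>q. V q $ 3) p)
    + (if i = 1 then pd j (\<lambda>q. V q $ 3) p
     else if i = 2 then \<epsilon> * pd j (\<lambda>q. V q $ 2) p
     else pd j (\<lambda>q. V q $ 1) p + f p * pd j (\<lambda>q. V q $ 3) p)"
  using exhaust_3[of i] exhaust_3[of j]
  by (elim disjE) (simp_all add: lie_derivative_metric_def sum_3 walker_metric_def)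

lemma ricci_yamabe_soliton_walker_iff:
  assumes \<epsilon>: "\<epsilon> \<in> {1, -1}" and "open M" "smooth_on f M"
  shows "ricci_yamabe_soliton M (walker_metric \<epsilon> f) V \<beta> lam 0 \<longleftrightarrow>
    (\<forall>p\<in>M.
       pd 1 (\<lambda>q. V q $ 3) p = 0 \<and>
       pd 2 (\<lambda>q. V q $ 3) p = - \<epsilon> * pd 1 (\<lambda>q. V q $ 2) p \<and>
       pd 2 (\<lambda>q. V q $ 2) p = - lam \<and>
       \<beta> * pd 1 (pd 1 f) p + pd 1 (\<lambda>q. V q $ 1) p + pd 3 (\<lambda>q. V q $ 3) p = - 2 * lam \<and>
       \<beta> * pd 1 (pd 2 f) p + pd 2 (\<lambda>q. V q $ 1) p + f p * pd 2 (\<lambda>q. V q $ 3) p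
         + \<epsilon> * pd 3 (\<lambda>q. V q $ 2) p = 0 \<and>
       \<beta> * ((\<epsilon> * f p * pd 1 (pd 1 f) p - pd 2 (pd 2 f) p) / \<epsilon>)
         + V p $ 1 * pd 1 f p + V p $ 2 * pd 2 f p + V p $ 3 * pd 3 f p
         + 2 * pd 3 (\<lambda>q. V q $ 1) p
         + 2 * f p * (pd 3 (\<lambda>q. V q $ 3) p + lam) = 0)"
  unfolding ricci_yamabe_soliton_def
proof (intro ball_cong refl)
  fix p assume "p \<in> M"
  show "(\<forall>i j. 2 * \<beta> * ricci (walker_metric \<epsilon> f) p i j
         + lie_derivative_metric V (walker_metric \<epsilon> f) p i j
       = (- 2 * lam + 0 * scalar_curvature (walker_metric \<epsilon> f) p) * walker_metric \<epsilon> f p $ i $ j) \<longleftrightarrow>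
      (pd 1 (\<lambda>q. V q $ 3) p = 0 \<and>
       pd 2 (\<lambda>q. V q $ 3) p = - \<epsilon> * pd 1 (\<lambda>q. V q $ 2) p \<and>
       pd 2 (\<lambda>q. V q $ 2) p = - lam \<and>
       \<beta> * pd 1 (pd 1 f) p + pd 1 (\<lambda>q. V q $ 1) p + pd 3 (\<lambda>q. V q $ 3) p = - 2 * lam \<and>
       \<beta> * pd 1 (pd 2 f) p + pd 2 (\<lambda>q. V q $ 1) p + f p * pd 2 (\<lambda>q. V q $ 3) p
         + \<epsilon> * pd 3 (\<lambda>q. V q $ 2) p = 0 \<and>
       \<beta> * ((\<epsilon> * f p * pd 1 (pd 1 f) p - pd 2 (pd 2 f) p) / \<epsilon>)
         + V p $ 1 * pd 1 f p + V p $ 2 * pd 2 f p + V p $ 3 * pd 3 f p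
         + 2 * pd 3 (\<lambda>q. V q $ 1) p
         + 2 * f p * (pd 3 (\<lambda>q. V q $ 3) p + lam) = 0)"
    unfolding ricci_walker[OF assms \<open>p \<in> M\<close>] lie_derivative_walker forall_3
    using \<epsilon> by (simp add: walker_metric_def) (auto simp: algebra_simps)
qed

subsection \<open>Functions constant along fibres\<close>

lemma vector_3_axis: "(vector [x, y, z] :: real^3) = x *\<^sub>R axis 1 1 + y *\<^sub>R axis 2 1 + z *\<^sub>R axis 3 1"
  by (simp add: vec_eq_iff forall_3 axis_def)

lemma vector_3_line:
  "(vector [x, y, z] :: real^3) = vector [0, y, z] + x *\<^sub>R axis 1 1"
  "(vector [x, y, z] :: real^3) = vector [x, 0, z] + y *\<^sub>R axis 2 1"
  "(vector [x, y, z] :: real^3) = vector [x, y, 0] + z *\<^sub>R axis 3 1"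
  by (simp_all add: vec_eq_iff forall_3 axis_def)

lemma has_real_derivative_coordinate_line:
  assumes "h differentiable (at (vector [x, y, z] :: real^3))"
  shows "((\<lambda>t. h (vector [t, y, z])) has_real_derivative pd 1 h (vector [x, y, z])) (at x)"
    and "((\<lambda>t. h (vector [x, t, z])) has_real_derivative pd 2 h (vector [x, y, z])) (at y)"
    and "((\<lambda>t. h (vector [x, y, t])) has_real_derivative pd 3 h (vector [x, y, z])) (at z)"
  using has_real_derivative_along_line[of h "vector [0, y, z]" x "axis 1 1"]
    has_real_derivative_along_line[of h "vector [x, 0, z]" y "axis 2 1"]
    has_real_derivative_along_line[of h "vector [x, y, 0]" z "axis 3 1"] assms
  by (simp_all add: pd_def vector_3_line[symmetric])

lemma open_affine_vimage:
  assumes "open M" "bounded_linear L"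
  shows "open {w. a + L w \<in> M}"
proof -
  have "continuous_on UNIV (\<lambda>w. a + L w)"
    by (intro continuous_on_add continuous_on_const bounded_linear.continuous_on[OF assms(2)] continuous_on_id)
  from open_vimage[OF assms(1) this] show ?thesis by (simp add: vimage_def)
qed

lemma open_coordinate_line:
  assumes "open (M :: (real^3) set)"
  shows "open {t. vector [t, y, z] \<in> M}" "open {t. vector [x, t, z] \<in> M}" "open {t. vector [x, y, t] \<in> M}"
  using open_affine_vimage[OF assms bounded_linear_scaleR_left[of "axis 1 1"], of "vector [0, y, z]"]
    open_affine_vimage[OF assms bounded_linear_scaleR_left[of "axis 2 1"], of "vector [x, 0, z]"]
    open_affine_vimage[OF assms bounded_linear_scaleR_left[of "axis 3 1"], of "vector [x, y, 0]"]
  by (simp_all add: vector_3_line[symmetric])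

text \<open>Locally \<open>H\<close> is \<open>h\<close> composed with an affine section of the projection, so it
  inherits the smoothness of \<open>h\<close>.\<close>

lemma smooth_on_descend:
  assumes "open M" "smooth_on h M"
    and "\<And>w. w \<in> T \<Longrightarrow> \<exists>a L. bounded_linear L \<and> a + L w \<in> M \<and> (\<forall>w'. a + L w' \<in> M \<longrightarrow> h (a + L w') = H w')"
  shows "smooth_on H T"
  unfolding smooth_on_def
proof (intro allI higher_differentiable_on_local)
  fix n w assume "w \<in> T"
  then obtain a L where L: "bounded_linear L" "a + L w \<in> M"
    and H: "\<And>w'. a + L w' \<in> M \<Longrightarrow> h (a + L w') = H w'"
    using assms(3) by blast
  let ?U = "{w. a + L w \<in> M}"
  have "open ?U" using open_affine_vimage assms(1) L(1) by blast
  then have "higher_differentiable_on n (\<lambda>w. h (a + L w)) ?U"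
    using assms(2) L(1) by (intro higher_differentiable_on_compose_affine) (auto simp: smooth_on_def)
  then have "higher_differentiable_on n H ?U"
    by (rule higher_differentiable_on_cong[OF \<open>open ?U\<close>, rotated]) (use H in auto)
  then show "\<exists>U. open U \<and> w \<in> U \<and> higher_differentiable_on n H U"
    using \<open>open ?U\<close> L(2) by auto
qed

text \<open>A formula valid only on \<open>M\<close> still determines the partial derivatives,
  because a coordinate line meets \<open>M\<close> in an open set of parameters. What remains is to
  differentiate \<open>k\<close> in one variable.\<close>

lemma pd_coordinate_line_eqI:
  assumes "open M" "h differentiable (at (vector [x, y, z] :: real^3))" "(vector [x, y, z] :: real^3) \<in> M"
  shows "(\<And>t. vector [t, y, z] \<in> M \<Longrightarrow> h (vector [t, y, z]) = k t) \<Longrightarrow> (k has_real_derivative d) (at x)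
      \<Longrightarrow> pd 1 h (vector [x, y, z]) = d"
    and "(\<And>t. vector [x, t, z] \<in> M \<Longrightarrow> h (vector [x, t, z]) = k t) \<Longrightarrow> (k has_real_derivative d) (at y)
      \<Longrightarrow> pd 2 h (vector [x, y, z]) = d"
    and "(\<And>t. vector [x, y, t] \<in> M \<Longrightarrow> h (vector [x, y, t]) = k t) \<Longrightarrow> (k has_real_derivative d) (at z)
      \<Longrightarrow> pd 3 h (vector [x, y, z]) = d"
proof -
  have *: "a = d" if "(g has_real_derivative a) (at s)" "(k has_real_derivative d) (at s)"
    "open U" "s \<in> U" "\<And>t. t \<in> U \<Longrightarrow> g t = k t" for g a s U
    using DERIV_unique[OF has_field_derivative_transform_within_open[OF that(1,3-5)] that(2)] .
  note line = has_real_derivative_coordinate_line[OF assms(2)]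
  show "pd 1 h (vector [x, y, z]) = d"
    if "\<And>t. vector [t, y, z] \<in> M \<Longrightarrow> h (vector [t, y, z]) = k t" "(k has_real_derivative d) (at x)"
    by (rule *[OF line(1) that(2) open_coordinate_line(1)[OF assms(1)]]) (use that(1) assms(3) in auto)
  show "pd 2 h (vector [x, y, z]) = d"
    if "\<And>t. vector [x, t, z] \<in> M \<Longrightarrow> h (vector [x, t, z]) = k t" "(k has_real_derivative d) (at y)"
    by (rule *[OF line(2) that(2) open_coordinate_line(2)[OF assms(1)]]) (use that(1) assms(3) in auto)
  show "pd 3 h (vector [x, y, z]) = d"
    if "\<And>t. vector [x, y, t] \<in> M \<Longrightarrow> h (vector [x, y, t]) = k t" "(k has_real_derivative d) (at z)"
    by (rule *[OF line(3) that(2) open_coordinate_line(3)[OF assms(1)]]) (use that(1) assms(3) in auto)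
qed

text \<open>A connected set of reals is convex, and a function with zero derivative on a convex set
  is constant.\<close>

lemma constant_along_x_fibres:
  assumes x_fibres: "\<And>y z. connected {x. (vector [x, y, z] :: real^3) \<in> M}"
    and "\<And>p. p \<in> M \<Longrightarrow> h differentiable (at p)" "\<And>p. p \<in> M \<Longrightarrow> pd 1 h p = 0"
    and "vector [x, y, z] \<in> M" "vector [x', y, z] \<in> M"
  shows "h (vector [x, y, z]) = h (vector [x', y, z])"
proof -
  have "((\<lambda>t. h (vector [t, y, z])) has_field_derivative 0) (at t within {x. vector [x, y, z] \<in> M})"
    if "t \<in> {x. vector [x, y, z] \<in> M}" for t
    using has_real_derivative_coordinate_line(1)[of h t y z] assms(2,3) that
    by (auto intro: has_field_derivative_at_within)
  then show ?thesis
    using has_field_derivative_zero_constant[of "{x. vector [x, y, z] \<in> M}"] x_fibres assms(4,5)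
    by (metis (no_types, lifting) is_interval_connected_1 is_interval_convex_1 mem_Collect_eq)
qed

lemma smooth_on_descend_yz:
  assumes "open (M :: (real^3) set)"
    and x_fibres: "\<And>y z. connected {x. (vector [x, y, z] :: real^3) \<in> M}"
    and h: "smooth_on h M" "\<And>p. p \<in> M \<Longrightarrow> pd 1 h p = 0"
  obtains H :: "real \<times> real \<Rightarrow> real" where
    "smooth_on H {(y, z). \<exists>x. (vector [x, y, z] :: real^3) \<in> M}"
    "\<And>x y z. vector [x, y, z] \<in> M \<Longrightarrow> H (y, z) = h (vector [x, y, z])"
    "\<And>x y z. vector [x, y, z] \<in> M \<Longrightarrow> deriv (\<lambda>s. H (s, z)) y = pd 2 h (vector [x, y, z])"
proof -
  \<comment> \<open>The chosen x may jump as (y, z) varies, but constancy along the fibre makes the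
    value independent of the choice.\<close>
  define H where "H = (\<lambda>(y, z). h (vector [SOME x. vector [x, y, z] \<in> M, y, z]))"
  note diff = smooth_on_imp_differentiable[OF h(1)]
  have H: "H (y, z) = h (vector [x, y, z])" if "vector [x, y, z] \<in> M" for x y z
    unfolding H_def prod.case
    using someI[of "\<lambda>x. vector [x, y, z] \<in> M", OF that] that
    by (intro constant_along_x_fibres[OF x_fibres diff h(2)])
  have "smooth_on H {(y, z). \<exists>x. vector [x, y, z] \<in> M}"
  proof (rule smooth_on_descend[OF assms(1) h(1)])
    fix w assume "w \<in> {(y, z). \<exists>x. (vector [x, y, z] :: real^3) \<in> M}"
    then obtain x y z where "w = (y, z)" "(vector [x, y, z] :: real^3) \<in> M" by auto
    moreover have "bounded_linear (\<lambda>w :: real \<times> real. fst w *\<^sub>R axis 2 1 + snd w *\<^sub>R axis 3 1 :: real^3)"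
      by (intro bounded_linear_intros)
    \<comment> \<open>The local section keeps \<open>x\<close> fixed at one point of the fibre over
      \<open>w\<close>. It meets \<open>M\<close> in a neighbourhood of \<open>w\<close>, where
      \<open>H\<close> is read off from \<open>h\<close> on a plane.\<close>
    moreover have "x *\<^sub>R axis 1 1 + (b *\<^sub>R axis 2 1 + c *\<^sub>R axis 3 1) = (vector [x, b, c] :: real^3)" for b c
      by (simp add: vector_3_axis add.assoc)
    ultimately show "\<exists>a L. bounded_linear L \<and> a + L w \<in> M \<and> (\<forall>w'. a + L w' \<in> M \<longrightarrow> h (a + L w') = H w')"
      using H by (intro exI[of _ "x *\<^sub>R axis 1 1"]
          exI[of _ "\<lambda>w. fst w *\<^sub>R axis 2 1 + snd w *\<^sub>R axis 3 1"]) (simp add: H[symmetric])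
  qed
  moreover have "deriv (\<lambda>s. H (s, z)) y = pd 2 h (vector [x, y, z])" if "vector [x, y, z] \<in> M" for x y z
    using that H
    by (intro DERIV_imp_deriv has_field_derivative_transform_within_open[OF
          has_real_derivative_coordinate_line(2)[OF diff[OF that]] open_coordinate_line(2)[OF assms(1)]])
      auto
  ultimately show thesis using H that by blast
qed

text \<open>Two points of a slice need not share an x for which the segment between them lies in
  \<open>M\<close>. So \<open>h\<close> first descends to a function of (y, z), whose y-derivative
  vanishes on the connected projection of the slice.\<close>

lemma constant_along_xy_slices:
  assumes "open (M :: (real^3) set)"
    and x_fibres: "\<And>y z. connected {x. (vector [x, y, z] :: real^3) \<in> M}"
    and y_fibres: "\<And>z. connected {y. \<exists>x. (vector [x, y, z] :: real^3) \<in> M}"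
    and h: "smooth_on h M" "\<And>p. p \<in> M \<Longrightarrow> pd 1 h p = 0" "\<And>p. p \<in> M \<Longrightarrow> pd 2 h p = 0"
    and p: "vector [x, y, z] \<in> M" "vector [x', y', z] \<in> M"
  shows "h (vector [x, y, z]) = h (vector [x', y', z])"
proof -
  let ?Y = "{y. \<exists>x. (vector [x, y, z] :: real^3) \<in> M}"
  obtain H where "smooth_on H {(y, z). \<exists>x. (vector [x, y, z] :: real^3) \<in> M}"
    and H: "\<And>x y z. vector [x, y, z] \<in> M \<Longrightarrow> H (y, z) = h (vector [x, y, z])"
    and "\<And>x y z. vector [x, y, z] \<in> M \<Longrightarrow> deriv (\<lambda>s. H (s, z)) y = pd 2 h (vector [x, y, z])"
    by (rule smooth_on_descend_yz[OF assms(1) x_fibres h(1,2)]) (assumption | rule that)+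
  have "((\<lambda>s. H (s, z)) has_field_derivative 0) (at t within ?Y)" if t: "t \<in> ?Y" for t
  proof -
    \<comment> \<open>Near \<open>t\<close> the function of y agrees with \<open>h\<close> on the
      line x = \<open>s\<close>, and there its derivative is \<open>pd 2 h\<close>, which is
      zero.\<close>
    obtain s where s: "vector [s, t, z] \<in> M" using t by blast
    have "((\<lambda>t. h (vector [s, t, z])) has_real_derivative 0) (at t)"
      using has_real_derivative_coordinate_line(2)[of h s t z] smooth_on_imp_differentiable[OF h(1) s] h(3)[OF s]
      by simp
    then have "((\<lambda>t. H (t, z)) has_real_derivative 0) (at t)"
      by (rule has_field_derivative_transform_within_open[OF _ open_coordinate_line(2)[OF assms(1)]])
        (use s H in auto)
    then show ?thesis by (rule has_field_derivative_at_within)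
  qed
  moreover have "convex ?Y"
    using y_fibres by (metis is_interval_connected_1 is_interval_convex_1)
  ultimately have "\<exists>c. \<forall>s\<in>?Y. H (s, z) = c"
    by (intro has_field_derivative_zero_constant) auto
  then obtain c where "H (s, z) = c" if "s \<in> ?Y" for s by blast
  moreover have "y \<in> ?Y" "y' \<in> ?Y" using p by auto
  ultimately have "H (y, z) = H (y', z)" by simp
  then show ?thesis using p H by simp
qed

lemma smooth_on_descend_z:
  assumes "open (M :: (real^3) set)"
    and x_fibres: "\<And>y z. connected {x. (vector [x, y, z] :: real^3) \<in> M}"
    and y_fibres: "\<And>z. connected {y. \<exists>x. (vector [x, y, z] :: real^3) \<in> M}"
    and h: "smooth_on h M" "\<And>p. p \<in> M \<Longrightarrow> pd 1 h p = 0" "\<And>p. p \<in> M \<Longrightarrow> pd 2 h p = 0"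
  obtains H :: "real \<Rightarrow> real" where
    "smooth_on H {z. \<exists>x y. (vector [x, y, z] :: real^3) \<in> M}"
    "\<And>x y z. vector [x, y, z] \<in> M \<Longrightarrow> H z = h (vector [x, y, z])"
    "\<And>x y z. vector [x, y, z] \<in> M \<Longrightarrow> deriv H z = pd 3 h (vector [x, y, z])"
proof -
  \<comment> \<open>Any point of \<open>M\<close> at height z may represent its slice, since
    \<open>h\<close> is constant there.\<close>
  define H where "H = (\<lambda>z. h (SOME p. p \<in> M \<and> p $ 3 = z))"
  have H: "H z = h (vector [x, y, z])" if "vector [x, y, z] \<in> M" for x y z
  proof -
    define p where "p = (SOME p. p \<in> M \<and> p $ 3 = z)"
    have "p \<in> M \<and> p $ 3 = z"
      unfolding p_def by (rule someI[of _ "vector [x, y, z]"]) (use that in simp)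
    moreover have "p = vector [p $ 1, p $ 2, p $ 3]" by (simp add: vec_eq_iff forall_3)
    ultimately show ?thesis
      using constant_along_xy_slices[OF assms, of "p $ 1" "p $ 2" z x y] that
      unfolding H_def p_def[symmetric] by metis
  qed
  have "smooth_on H {z. \<exists>x y. (vector [x, y, z] :: real^3) \<in> M}"
  proof (rule smooth_on_descend[OF assms(1) h(1)])
    fix z assume "z \<in> {z. \<exists>x y. (vector [x, y, z] :: real^3) \<in> M}"
    then obtain x y where "(vector [x, y, z] :: real^3) \<in> M" by auto
    \<comment> \<open>The section is the vertical line through a point of the slice.\<close>
    moreover have "vector [x, y, 0] + c *\<^sub>R axis 3 1 = (vector [x, y, c] :: real^3)" for c
      using vector_3_line(3) by metis
    ultimately show "\<exists>a L. bounded_linear L \<and> a + L z \<in> M \<and> (\<forall>z'. a + L z' \<in> M \<longrightarrow> h (a + L z') = H z')"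
      by (intro exI[of _ "vector [x, y, 0]"] exI[of _ "\<lambda>z. z *\<^sub>R axis 3 1"])
        (simp add: H[symmetric] bounded_linear_scaleR_left)
  qed
  moreover have "deriv H z = pd 3 h (vector [x, y, z])" if "vector [x, y, z] \<in> M" for x y z
    using that H
    by (intro DERIV_imp_deriv has_field_derivative_transform_within_open[OF
          has_real_derivative_coordinate_line(3)[OF smooth_on_imp_differentiable[OF h(1) that]]
          open_coordinate_line(3)[OF assms(1)]])
      auto
  ultimately show thesis using H that by blast
qed

subsection \<open>Solitons\<close>

theorem theorem3p6:
  fixes M :: "(real^3) set" and f :: "real^3 \<Rightarrow> real" and V :: "real^3 \<Rightarrow> real^3"
    and \<epsilon> \<beta> lam :: real
  assumes "open M"
    and x_fibres: "\<And>y z. connected {x. (vector [x, y, z] :: real^3) \<in> M}"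
    and y_fibres: "\<And>z. connected {y. \<exists>x. (vector [x, y, z] :: real^3) \<in> M}"
    and "\<epsilon> \<in> {1, -1}"
    and "smooth_on f M"
    and "smooth_on V M"
  shows "ricci_yamabe_soliton M (walker_metric \<epsilon> f) V \<beta> lam 0 \<longleftrightarrow>
    (\<exists>(Z1 :: real \<Rightarrow> real) (Z2 :: real \<Rightarrow> real) (Z3 :: real \<Rightarrow> real) (\<xi> :: real \<times> real \<Rightarrow> real).
       smooth_on Z1 {z. \<exists>x y. (vector [x, y, z] :: real^3) \<in> M} \<and>
       smooth_on Z2 {z. \<exists>x y. (vector [x, y, z] :: real^3) \<in> M} \<and>
       smooth_on Z3 {z. \<exists>x y. (vector [x, y, z] :: real^3) \<in> M} \<and>
       smooth_on \<xi> {(y, z). \<exists>x. (vector [x, y, z] :: real^3) \<in> M} \<and>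
       (\<forall>x y z. \<forall>p :: real^3. p = vector [x, y, z] \<longrightarrow> p \<in> M \<longrightarrow>
          V p $ 1 = - \<beta> * pd 1 f p - y * x * deriv Z1 z - x * deriv Z2 z - 2 * lam * x + \<xi> (y, z) \<and>
          V p $ 2 = - \<epsilon> * Z1 z * x - lam * y + Z3 z \<and>
          V p $ 3 = Z1 z * y + Z2 z \<and>
          - 2 * x * deriv Z1 z + deriv (\<lambda>s. \<xi> (s, z)) y + f p * Z1 z + \<epsilon> * deriv Z3 z = 0 \<and>
          \<beta> * ((\<epsilon> * f p * pd 1 (pd 1 f) p - pd 2 (pd 2 f) p) / \<epsilon>)
            + V p $ 1 * pd 1 f p + V p $ 2 * pd 2 f p + V p $ 3 * pd 3 f p
            + 2 * pd 3 (\<lambda>q. V q $ 1) p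
            + 2 * f p * (pd 3 (\<lambda>q. V q $ 3) p + lam) = 0))"
proof -
  let "?L \<longleftrightarrow> (\<exists>Z1 Z2 Z3 \<xi>. ?R Z1 Z2 Z3 \<xi>)" = ?thesis
  show ?thesis
  proof

    \<comment> \<open>From the soliton equation to the normal form\<close>
    assume "ricci_yamabe_soliton M (walker_metric \<epsilon> f) V \<beta> lam 0"
    note eqs = this[unfolded ricci_yamabe_soliton_walker_iff[OF assms(4,1,5)], rule_format]
    define U1 U2 U3 where U_def: "U1 = (\<lambda>q. V q $ 1)" "U2 = (\<lambda>q. V q $ 2)" "U3 = (\<lambda>q. V q $ 3)"
    \<comment> \<open>Each function is a line of the desired formula solved for its unknown. In
      \<open>X\<close> the terms y x Z1' + x Z2' are merged into x times the z-derivative of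
      V^3.\<close>
    define G1 G2 G3 X where G_def: "G1 = pd 2 U3" "G2 = (\<lambda>q. U3 q - q $ 2 * G1 q)"
      "G3 = (\<lambda>q. U2 q + \<epsilon> * (q $ 1 * G1 q) + lam * q $ 2)"
      "X = (\<lambda>q. U1 q + \<beta> * pd 1 f q + q $ 1 * pd 3 U3 q + 2 * lam * q $ 1)"
    have smooth_U: "smooth_on U1 M" "smooth_on U2 M" "smooth_on U3 M"
      unfolding U_def by (intro smooth_on_component assms)+
    have smooth_G: "smooth_on G1 M" "smooth_on G2 M" "smooth_on G3 M" "smooth_on X M"
      unfolding G_def by (intro smooth_on_intros smooth_U assms)+
    have \<epsilon>\<epsilon>: "\<epsilon> * \<epsilon> = 1" using assms(4) by auto
    have pd1_U3: "pd 1 U3 p = 0" and pd2_U3: "pd 2 U3 p = - \<epsilon> * pd 1 U2 p"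
      and pd2_U2: "pd 2 U2 p = - lam"
      and pd1_U1: "\<beta> * pd 1 (pd 1 f) p + pd 1 U1 p + pd 3 U3 p = - 2 * lam"
      and pd2_U1: "\<beta> * pd 1 (pd 2 f) p + pd 2 U1 p + f p * pd 2 U3 p + \<epsilon> * pd 3 U2 p = 0"
      if "p \<in> M" for p
      using eqs[OF that] unfolding U_def by - (elim conjE, assumption)+
    \<comment> \<open>Multiplying equation 12 by \<epsilon> solves it for the x-derivative of
      V^2.\<close>
    have pd1_U2: "pd 1 U2 p = - \<epsilon> * G1 p" if "p \<in> M" for p
      using pd2_U3[OF that] \<epsilon>\<epsilon> by (simp add: G_def mult.assoc[symmetric])
    \<comment> \<open>Since \<open>M\<close> is open, an identity that holds on \<open>M\<close> may
      be differentiated there.\<close>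
    have pd_on_M: "pd i h p = pd i k p" if "p \<in> M" "smooth_on h M" "\<And>q. q \<in> M \<Longrightarrow> h q = k q"
      for i p and h k :: "real^3 \<Rightarrow> real"
      by (rule pd_cong[OF assms(1) that(1) that(3) smooth_on_imp_differentiable[OF that(2,1)]])
    have pd1_pd_U3: "pd 1 (pd i U3) p = 0" if "p \<in> M" for p i
    proof -
      have "pd i (pd 1 U3) p = pd i (\<lambda>q. 0) p"
        by (rule pd_on_M[OF that smooth_on_pd[OF smooth_U(3)] pd1_U3])
      then show ?thesis using pd_commute[OF assms(1) smooth_U(3) that, of i 1] by simp
    qed
    \<comment> \<open>This makes V^3 affine in y: its second y-derivative is -\<epsilon> times the
      mixed x-y derivative of V^2, and V^2 has the constant y-derivative
      \<open>- lam\<close>.\<close>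
    have pd2_G1: "pd 2 G1 p = 0" if "p \<in> M" for p
    proof -
      have d: "pd 1 U2 differentiable (at p)"
        using smooth_U that by (intro smooth_on_imp_differentiable[of _ M] smooth_on_pd)
      have "pd 2 G1 p = pd 2 (\<lambda>q. - \<epsilon> * pd 1 U2 q) p"
        by (rule pd_on_M[OF that smooth_G(1)]) (simp add: G_def pd2_U3)
      also have "\<dots> = - \<epsilon> * pd 1 (pd 2 U2) p"
        by (simp only: pd_mult[OF differentiable_const d] pd_const mult_zero_left add_0_right
            pd_commute[OF assms(1) smooth_U(2) that, of 2 1])
      also have "pd 1 (pd 2 U2) p = pd 1 (\<lambda>q. - lam) p"
        by (rule pd_on_M[OF that smooth_on_pd[OF smooth_U(2)] pd2_U2])
      finally show ?thesis by simp
    qed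
    note pd_rules = pd_add pd_diff pd_mult pd_coord
    have diff: "U1 differentiable (at p)" "U2 differentiable (at p)" "U3 differentiable (at p)"
        "G1 differentiable (at p)" "pd i f differentiable (at p)" "pd i U3 differentiable (at p)"
        "(\<lambda>q. q $ j) differentiable (at p)"
      if "p \<in> M" for p :: "real^3" and i j
      using smooth_U smooth_G(1) assms(5) smooth_on_coord[OF assms(1)] that
      by (auto intro: smooth_on_imp_differentiable smooth_on_pd)
    have pd_G2: "pd i G2 p = pd i U3 p - (p $ 2 * pd i G1 p + (if i = 2 then G1 p else 0))" if "p \<in> M" for p i
      unfolding G_def(2) using diff[OF that]
      by (simp add: pd_rules differentiable_mult)
    have pd_G3: "pd i G3 p = pd i U2 p + \<epsilon> * (p $ 1 * pd i G1 p + (if i = 1 then G1 p else 0))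
        + lam * (if i = 2 then 1 else 0)" if "p \<in> M" for p i
      unfolding G_def(3) using diff[OF that]
      by (simp add: pd_rules differentiable_mult differentiable_add)
    have pd_X: "pd i X p = pd i U1 p + \<beta> * pd i (pd 1 f) p + (p $ 1 * pd i (pd 3 U3) p
        + (if i = 1 then pd 3 U3 p else 0)) + 2 * lam * (if i = 1 then 1 else 0)" if "p \<in> M" for p i
      unfolding G_def(4) using diff[OF that]
      by (simp add: pd_rules differentiable_mult differentiable_add)
    have pd1_G1: "pd 1 G1 p = 0" if "p \<in> M" for p
      using pd1_pd_U3[OF that] by (simp add: G_def)
    have pd1_G2: "pd 1 G2 p = 0" and pd2_G2: "pd 2 G2 p = 0" if "p \<in> M" for p
      using that by (simp_all add: pd_G2 pd1_G1 pd2_G1 pd1_U3 G_def(1)[symmetric])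
    \<comment> \<open>The summands added to V^2 in \<open>G3\<close> cancel exactly the derivatives
      prescribed by equations 12 and 22.\<close>
    have pd1_G3: "pd 1 G3 p = 0" and pd2_G3: "pd 2 G3 p = 0" if "p \<in> M" for p
      using that by (simp_all add: pd_G3 pd1_G1 pd2_G1 pd1_U2 pd2_U2)
    \<comment> \<open>Because \<open>pd 3 U3\<close> has no x-derivative, this is equation
      13.\<close>
    have pd1_X: "pd 1 X p = 0" if "p \<in> M" for p
      using that pd1_U1[OF that] by (simp add: pd_X pd1_pd_U3)
    obtain Z1 where Z1: "smooth_on Z1 {z. \<exists>x y. (vector [x, y, z] :: real^3) \<in> M}"
      "\<And>x y z. vector [x, y, z] \<in> M \<Longrightarrow> Z1 z = G1 (vector [x, y, z])"
      "\<And>x y z. vector [x, y, z] \<in> M \<Longrightarrow> deriv Z1 z = pd 3 G1 (vector [x, y, z])"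
      by (rule smooth_on_descend_z[OF assms(1-3) smooth_G(1) pd1_G1 pd2_G1]) (assumption | rule that)+
    obtain Z2 where Z2: "smooth_on Z2 {z. \<exists>x y. (vector [x, y, z] :: real^3) \<in> M}"
      "\<And>x y z. vector [x, y, z] \<in> M \<Longrightarrow> Z2 z = G2 (vector [x, y, z])"
      "\<And>x y z. vector [x, y, z] \<in> M \<Longrightarrow> deriv Z2 z = pd 3 G2 (vector [x, y, z])"
      by (rule smooth_on_descend_z[OF assms(1-3) smooth_G(2) pd1_G2 pd2_G2]) (assumption | rule that)+
    obtain Z3 where Z3: "smooth_on Z3 {z. \<exists>x y. (vector [x, y, z] :: real^3) \<in> M}"
      "\<And>x y z. vector [x, y, z] \<in> M \<Longrightarrow> Z3 z = G3 (vector [x, y, z])"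
      "\<And>x y z. vector [x, y, z] \<in> M \<Longrightarrow> deriv Z3 z = pd 3 G3 (vector [x, y, z])"
      by (rule smooth_on_descend_z[OF assms(1-3) smooth_G(3) pd1_G3 pd2_G3]) (assumption | rule that)+
    obtain \<xi> where \<xi>: "smooth_on \<xi> {(y, z). \<exists>x. (vector [x, y, z] :: real^3) \<in> M}"
      "\<And>x y z. vector [x, y, z] \<in> M \<Longrightarrow> \<xi> (y, z) = X (vector [x, y, z])"
      "\<And>x y z. vector [x, y, z] \<in> M \<Longrightarrow> deriv (\<lambda>s. \<xi> (s, z)) y = pd 2 X (vector [x, y, z])"
      by (rule smooth_on_descend_yz[OF assms(1,2) smooth_G(4) pd1_X]) (assumption | rule that)+
    have sol: "V p $ 1 = - \<beta> * pd 1 f p - y * x * deriv Z1 z - x * deriv Z2 z - 2 * lam * x + \<xi> (y, z) \<and>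
          V p $ 2 = - \<epsilon> * Z1 z * x - lam * y + Z3 z \<and>
          V p $ 3 = Z1 z * y + Z2 z \<and>
          - 2 * x * deriv Z1 z + deriv (\<lambda>s. \<xi> (s, z)) y + f p * Z1 z + \<epsilon> * deriv Z3 z = 0"
      if p: "p = vector [x, y, z]" "p \<in> M" for x y z p
    proof -
      have coords: "p $ 1 = x" "p $ 2 = y" using p by simp_all
      have vals: "Z1 z = G1 p" "Z2 z = G2 p" "Z3 z = G3 p" "\<xi> (y, z) = X p"
        "deriv Z1 z = pd 3 G1 p" "deriv Z2 z = pd 3 G2 p" "deriv Z3 z = pd 3 G3 p"
        "deriv (\<lambda>s. \<xi> (s, z)) y = pd 2 X p"
        unfolding p(1)
        by (rule Z1(2) Z2(2) Z3(2) \<xi>(2) Z1(3) Z2(3) Z3(3) \<xi>(3), use p in simp)+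
      \<comment> \<open>By \<open>pd_G2\<close> the sum y Z1' + Z2' is again the z-derivative of
        V^3, which was absorbed into \<open>X\<close>.\<close>
      have "V p $ 1 = - \<beta> * pd 1 f p - y * x * deriv Z1 z - x * deriv Z2 z - 2 * lam * x + \<xi> (y, z)"
        unfolding vals pd_G2[OF p(2)] coords
        by (simp add: G_def(4) U_def(1) coords algebra_simps)
      moreover have "V p $ 2 = - \<epsilon> * Z1 z * x - lam * y + Z3 z"
        unfolding vals by (simp add: G_def(3) U_def(2) coords)
      moreover have "V p $ 3 = Z1 z * y + Z2 z"
        unfolding vals by (simp add: G_def(2) U_def(3) coords)
      moreover have "- 2 * x * deriv Z1 z + deriv (\<lambda>s. \<xi> (s, z)) y + f p * Z1 z + \<epsilon> * deriv Z3 z = 0"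
      proof -
        have "pd 2 (pd 1 f) p = pd 1 (pd 2 f) p" "pd 2 (pd 3 U3) p = pd 3 G1 p"
          using pd_commute[OF assms(1) assms(5) p(2)] pd_commute[OF assms(1) smooth_U(3) p(2)]
          by (simp_all add: G_def)
        \<comment> \<open>The y-derivative of \<open>X\<close> contributes x Z1' and the term
          \<epsilon> Z3' contributes \<epsilon>^2 x Z1'. Against -2 x Z1' there remains the multiple
          \<epsilon>^2 - 1 = 0, and the rest is equation 23.\<close>
        then have "- 2 * x * deriv Z1 z + deriv (\<lambda>s. \<xi> (s, z)) y + f p * Z1 z + \<epsilon> * deriv Z3 z
            = (\<beta> * pd 1 (pd 2 f) p + pd 2 U1 p + f p * pd 2 U3 p + \<epsilon> * pd 3 U2 p)
              + (\<epsilon> * \<epsilon> - 1) * (x * pd 3 G1 p)"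
          unfolding vals pd_G3[OF p(2)] pd_X[OF p(2)] coords G_def(1)[symmetric]
          by (simp add: algebra_simps)
        then show ?thesis using pd2_U1[OF p(2)] \<epsilon>\<epsilon> by simp
      qed
      ultimately show ?thesis by (intro conjI)
    qed
    show "\<exists>Z1 Z2 Z3 \<xi>. ?R Z1 Z2 Z3 \<xi>"
    proof (rule exI[of _ Z1], rule exI[of _ Z2], rule exI[of _ Z3], rule exI[of _ \<xi>],
        intro conjI[OF Z1(1) conjI[OF Z2(1) conjI[OF Z3(1) conjI[OF \<xi>(1)]]]] allI impI, goal_cases)
      case (1 x y z p)
      \<comment> \<open>The last condition is equation 33 unchanged.\<close>
      show ?case
        using sol[OF 1] eqs[OF 1(2)] by (elim conjE) (intro conjI, assumption+)
    qed
  next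

    \<comment> \<open>From the normal form back to the soliton equation\<close>
    assume "\<exists>Z1 Z2 Z3 \<xi>. ?R Z1 Z2 Z3 \<xi>"
    then obtain Z1 Z2 Z3 \<xi> where R: "?R Z1 Z2 Z3 \<xi>" by blast
    then have smooth_Z:
        "smooth_on Z1 {z. \<exists>x y. (vector [x, y, z] :: real^3) \<in> M}"
        "smooth_on Z2 {z. \<exists>x y. (vector [x, y, z] :: real^3) \<in> M}"
        "smooth_on Z3 {z. \<exists>x y. (vector [x, y, z] :: real^3) \<in> M}"
        "smooth_on \<xi> {(y, z). \<exists>x. (vector [x, y, z] :: real^3) \<in> M}"
      by - (elim conjE, assumption)+
    note eqs = R[THEN conjunct2, THEN conjunct2, THEN conjunct2, THEN conjunct2, rule_format]
    have V1: "V p $ 1 = - \<beta> * pd 1 f p - y * x * deriv Z1 z - x * deriv Z2 z - 2 * lam * x + \<xi> (y, z)"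
      and V2: "V p $ 2 = - \<epsilon> * Z1 z * x - lam * y + Z3 z"
      and V3: "V p $ 3 = Z1 z * y + Z2 z"
      and E1: "- 2 * x * deriv Z1 z + deriv (\<lambda>s. \<xi> (s, z)) y + f p * Z1 z + \<epsilon> * deriv Z3 z = 0"
      and E2: "\<beta> * ((\<epsilon> * f p * pd 1 (pd 1 f) p - pd 2 (pd 2 f) p) / \<epsilon>)
          + V p $ 1 * pd 1 f p + V p $ 2 * pd 2 f p + V p $ 3 * pd 3 f p
          + 2 * pd 3 (\<lambda>q. V q $ 1) p + 2 * f p * (pd 3 (\<lambda>q. V q $ 3) p + lam) = 0"
      if "p = vector [x, y, z]" "p \<in> M" for x y z p
      using eqs[OF that] by - (elim conjE, assumption)+
    show "ricci_yamabe_soliton M (walker_metric \<epsilon> f) V \<beta> lam 0"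
      unfolding ricci_yamabe_soliton_walker_iff[OF assms(4,1,5)]
    proof (intro ballI, goal_cases)
      case (1 p)
      obtain x y z where p: "p = vector [x, y, z]"
        using forall_vector_3[of "\<lambda>p. \<exists>x y z. p = vector [x, y, z]"] by blast
      with \<open>p \<in> M\<close> have M: "vector [x, y, z] \<in> M" by simp
      have diff: "(\<lambda>q. V q $ i) differentiable (at p)" "pd i f differentiable (at p)" for i
        using assms \<open>p \<in> M\<close> by (auto intro: smooth_on_imp_differentiable[of _ M] smooth_on_component smooth_on_pd)
      \<comment> \<open>The formulas for V are known on \<open>M\<close> only. These instances
        reduce each partial derivative at \<open>p\<close> to differentiating an explicit expression
        in one coordinate.\<close>
      note pd_eqI = pd_coordinate_line_eqI[OF assms(1) diff(1)[unfolded p] M, folded p]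
      have "z \<in> {z. \<exists>x y. (vector [x, y, z] :: real^3) \<in> M}" using M by blast
      then have Z [derivative_intros]: "(Z1 has_real_derivative deriv Z1 z) (at z)"
        "(Z2 has_real_derivative deriv Z2 z) (at z)" "(Z3 has_real_derivative deriv Z3 z) (at z)"
        using smooth_Z(1-3) by (auto simp: DERIV_deriv_iff_real_differentiable intro: smooth_on_imp_differentiable)
      have "\<xi> differentiable (at (y, z))"
        using smooth_Z(4) M by (intro smooth_on_imp_differentiable) auto
      then have "(\<lambda>s. \<xi> (s, z)) differentiable (at y)"
        by (intro differentiable_compose[of \<xi> "\<lambda>s. (s, z)"] differentiable_Pair) auto
      then have \<xi> [derivative_intros]: "((\<lambda>s. \<xi> (s, z)) has_real_derivative deriv (\<lambda>s. \<xi> (s, z)) y) (at y)"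
        by (simp add: DERIV_deriv_iff_real_differentiable)
      note f [derivative_intros] = has_real_derivative_coordinate_line[OF diff(2)[unfolded p], folded p]
      have "pd 1 (\<lambda>q. V q $ 3) p = 0"
        by (rule pd_eqI(1)[OF V3[OF refl]]) (auto intro!: derivative_eq_intros)
      moreover have V32: "pd 2 (\<lambda>q. V q $ 3) p = Z1 z"
        by (rule pd_eqI(2)[OF V3[OF refl]]) (auto intro!: derivative_eq_intros)
      moreover have "pd 3 (\<lambda>q. V q $ 3) p = deriv Z1 z * y + deriv Z2 z"
        by (rule pd_eqI(3)[OF V3[OF refl]]) (auto intro!: derivative_eq_intros)
      moreover have "pd 1 (\<lambda>q. V q $ 2) p = - \<epsilon> * Z1 z"
        by (rule pd_eqI(1)[OF V2[OF refl]]) (auto intro!: derivative_eq_intros)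
      moreover have "pd 2 (\<lambda>q. V q $ 2) p = - lam"
        by (rule pd_eqI(2)[OF V2[OF refl]]) (auto intro!: derivative_eq_intros)
      moreover have V23: "pd 3 (\<lambda>q. V q $ 2) p = - \<epsilon> * deriv Z1 z * x + deriv Z3 z"
        by (rule pd_eqI(3)[OF V2[OF refl]]) (auto intro!: derivative_eq_intros)
      moreover have "pd 1 (\<lambda>q. V q $ 1) p = - \<beta> * pd 1 (pd 1 f) p - y * deriv Z1 z - deriv Z2 z - 2 * lam"
        by (rule pd_eqI(1)[OF V1[OF refl]]) (auto intro!: derivative_eq_intros)
      moreover have V12: "pd 2 (\<lambda>q. V q $ 1) p = - \<beta> * pd 1 (pd 2 f) p - x * deriv Z1 z + deriv (\<lambda>s. \<xi> (s, z)) y"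
        \<comment> \<open>Differentiating V^1 in y produces \<open>pd 2 (pd 1 f) p\<close>, whereas
          equation 23 carries the other order.\<close>
        unfolding pd_commute[OF assms(1,5) \<open>p \<in> M\<close>, of 1 2]
        by (rule pd_eqI(2)[OF V1[OF refl]]) (auto intro!: derivative_eq_intros)
      moreover have \<epsilon>\<epsilon>: "\<epsilon> * \<epsilon> = 1" using assms(4) by auto
      \<comment> \<open>V^1 and V^2 contribute -x Z1' and -\<epsilon>^2 x Z1', which together make
        the -2 x Z1' of the first constraint since \<epsilon>^2 = 1.\<close>
      moreover have "\<beta> * pd 1 (pd 2 f) p + pd 2 (\<lambda>q. V q $ 1) p + f p * pd 2 (\<lambda>q. V q $ 3) p
          + \<epsilon> * pd 3 (\<lambda>q. V q $ 2) p
        = (- 2 * x * deriv Z1 z + deriv (\<lambda>s. \<xi> (s, z)) y + f p * Z1 z + \<epsilon> * deriv Z3 z)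
          + (1 - \<epsilon> * \<epsilon>) * (x * deriv Z1 z)"
        unfolding V12 V32 V23 by (simp add: algebra_simps)
      then have "\<beta> * pd 1 (pd 2 f) p + pd 2 (\<lambda>q. V q $ 1) p + f p * pd 2 (\<lambda>q. V q $ 3) p
          + \<epsilon> * pd 3 (\<lambda>q. V q $ 2) p = 0"
        unfolding E1[OF p \<open>p \<in> M\<close>] \<epsilon>\<epsilon> by simp
      ultimately show ?case
        using E2[OF p \<open>p \<in> M\<close>] by (intro conjI) (assumption | simp add: mult.assoc[symmetric])+
    qed
  qed
qed

end
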